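(* Let $d\geq 2$ and $\gamma\geq 1$ be integers. Then $k(d,\gamma)\leq \lfloor d/2\rfloor$.
   Context: A graph $G=(V,E)$ is $k$-linked if $|V|\geq 2k$ and for every choice of $2k$ distinct vertices $s_1,\dots,s_k,t_1,\dots,t_k$ there exist $k$ pairwise vertex-disjoint paths $L_1,\dots,L_k$ with $L_i$ joining $s_i$ and $t_i$; a polytope is $k$-linked if its graph (vertices and edges) is. For a polytope $P$, $k(P)=\max\{k : P \text{ is } k\text{-linked}\}$. For $d,\gamma\geq 0$ let $\mathcal{P}_d^\gamma$ be the class of $d$-polytopes with $d+\gamma+1$ vertices (up to combinatorial equivalence), and $k(d,\gamma)=\max\{k : k(P)\geq k \text{ for all } P\in\mathcal{P}_d^\gamma\}$. *)

theory Defs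
  imports "HOL-Analysis.Analysis"
begin

text \<open>
  A simple graph is given by a vertex set \<open>V\<close> and a set \<open>E\<close> of two-element subsets of \<open>V\<close>;
  a path is the list of its vertices in order.
\<close>

definition graph_path :: "'a set \<Rightarrow> 'a set set \<Rightarrow> 'a list \<Rightarrow> bool" where
  "graph_path V E p \<longleftrightarrow>
     p \<noteq> [] \<and> distinct p \<and> set p \<subseteq> V \<and> (\<forall>i. Suc i < length p \<longrightarrow> {p ! i, p ! Suc i} \<in> E)"

definition graph_path_joins :: "'a set \<Rightarrow> 'a set set \<Rightarrow> 'a list \<Rightarrow> 'a \<Rightarrow> 'a \<Rightarrow> bool" where
  "graph_path_joins V E p x y \<longleftrightarrow> graph_path V E p \<and> hd p = x \<and> last p = y"

definition k_linked :: "nat \<Rightarrow> 'a set \<Rightarrow> 'a set set \<Rightarrow> bool" where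
  "k_linked k V E \<longleftrightarrow>
     card V \<ge> 2 * k \<and>
     (\<forall>s t. s ` {..<k} \<subseteq> V \<and> t ` {..<k} \<subseteq> V \<and>
            inj_on s {..<k} \<and> inj_on t {..<k} \<and> s ` {..<k} \<inter> t ` {..<k} = {} \<longrightarrow>
        (\<exists>L. (\<forall>i<k. graph_path_joins V E (L i) (s i) (t i)) \<and>
             (\<forall>i<k. \<forall>j<k. i \<noteq> j \<longrightarrow> set (L i) \<inter> set (L j) = {})))"

definition polytope_vertices :: "'a::euclidean_space set \<Rightarrow> 'a set" where
  "polytope_vertices P = {x. x extreme_point_of P}"

definition polytope_edges :: "'a::euclidean_space set \<Rightarrow> 'a set set" where
  "polytope_edges P = {{x, y} | x y. closed_segment x y edge_of P}"

text \<open>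
  For a polytope \<open>P\<close> the set below contains \<open>0\<close> and is bounded by half the number of vertices.
\<close>

definition linkedness :: "'a::euclidean_space set \<Rightarrow> nat" where
  "linkedness P = Max {k. k_linked k (polytope_vertices P) (polytope_edges P)}"

text \<open>
  The \<open>d\<close>-polytopes with \<open>d + \<gamma> + 1\<close> vertices lying in the Euclidean space \<open>'a\<close>.  They are not
  identified up to combinatorial equivalence: combinatorially equivalent polytopes have isomorphic
  graphs, so the identification does not affect statements about linkedness.  If \<open>d \<le> DIM('a)\<close>,
  every combinatorial type of \<open>d\<close>-polytope occurs in \<open>'a\<close>.
\<close>

definition polytope_class :: "nat \<Rightarrow> nat \<Rightarrow> 'a::euclidean_space set set" where
  "polytope_class d \<gamma> =
     {P. polytope P \<and> aff_dim P = int d \<and> card (polytope_vertices P) = d + \<gamma> + 1}"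

text \<open>
  The maximum is attained whenever \<open>polytope_class d \<gamma>\<close> is nonempty, in particular for
  \<open>2 \<le> d \<le> DIM('a)\<close>.
\<close>

definition min_linkedness :: "'a::euclidean_space itself \<Rightarrow> nat \<Rightarrow> nat \<Rightarrow> nat" where
  "min_linkedness _ d \<gamma> =
     Max {k. \<forall>P \<in> (polytope_class d \<gamma> :: 'a set set). linkedness P \<ge> k}"

end

theory Submission
  imports Defs
begin

text \<open>
  The \<open>(d - 2)\<close>-fold pyramid over a polygon with \<open>\<gamma> + 3 \<ge> 4\<close> vertices has \<open>d + \<gamma> + 1\<close> vertices.
  Let \<open>v\<^sub>1, v\<^sub>2, v\<^sub>3, v\<^sub>4\<close> be consecutive vertices of the polygon and ask for disjoint paths joining
  \<open>v\<^sub>1\<close> to \<open>v\<^sub>3\<close> and \<open>v\<^sub>2\<close> to \<open>v\<^sub>4\<close>. The polygon neighbours of \<open>v\<^sub>3\<close> are \<open>v\<^sub>2, v\<^sub>4\<close> and those of \<open>v\<^sub>2\<close>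
  are \<open>v\<^sub>1, v\<^sub>3\<close>, so each of the two paths has to use an apex. If \<open>k > d div 2\<close>, then the remaining
  \<open>2 k - 4 \<ge> d - 3\<close> terminals can be chosen so as to occupy all of the \<open>d - 2\<close> apexes but at most one.
\<close>

section \<open>Paths, and an obstruction to linkedness in graphs\<close>

lemma k_linked_0: "k_linked 0 V E"
  by (simp add: k_linked_def)

lemma graph_path_joins_ends:
  assumes "graph_path_joins V E p x y"
  shows "x \<in> set p" "y \<in> set p" "set p \<subseteq> V"
  using assms by (auto simp: graph_path_joins_def graph_path_def)

lemma graph_path_joins_second:
  assumes "graph_path_joins V E p x y" "x \<noteq> y"
  obtains z where "z \<in> set p" "{x, z} \<in> E" "z \<noteq> x"
proof -
  have p: "p \<noteq> []" "distinct p" "hd p = x" "last p = y"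
    "\<And>i. Suc i < length p \<Longrightarrow> {p ! i, p ! Suc i} \<in> E"
    using assms by (auto simp: graph_path_joins_def graph_path_def)
  have len: "1 < length p"
    using p assms(2) by (cases p) auto
  have "p ! 0 = x"
    using p by (simp add: hd_conv_nth)
  moreover have "p ! 1 \<noteq> p ! 0"
    using p len by (auto simp: nth_eq_iff_index_eq)
  ultimately show thesis
    using that[of "p ! 1"] p(5)[of 0] len by auto
qed

lemma graph_path_joins_rev:
  assumes "graph_path_joins V E p x y"
  shows "graph_path_joins V E (rev p) y x"
proof -
  have p: "p \<noteq> []" "distinct p" "set p \<subseteq> V" "hd p = x" "last p = y"
    "\<And>i. Suc i < length p \<Longrightarrow> {p ! i, p ! Suc i} \<in> E"
    using assms by (auto simp: graph_path_joins_def graph_path_def)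
  have "{rev p ! i, rev p ! Suc i} \<in> E" if "Suc i < length p" for i
  proof -
    have "length p - Suc i = Suc (length p - Suc (Suc i))"
      using that by simp
    then show ?thesis
      using p(6)[of "length p - Suc (Suc i)"] that by (simp add: rev_nth insert_commute)
  qed
  then show ?thesis
    using p by (auto simp: graph_path_joins_def graph_path_def hd_rev last_rev)
qed

text \<open>Consecutive entries of \<open>us\<close> serve as terminal pairs. If \<open>k\<close>
  exceeds \<open>d div 2\<close>, the terminals cover at least the first \<open>d + 1\<close>
  entries, so among the first \<open>d + 2\<close> only \<open>us ! (d + 1)\<close> can be free. The
  first two paths, followed from \<open>us ! 1\<close> and \<open>us ! 2\<close>, cannot step
  directly to their other ends, so both need that one vertex.\<close>

lemma k_linked_le_of_crossing:
  fixes us :: "'a list"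
  assumes us: "distinct us" "set us = V" "4 \<le> length us" and "2 \<le> d"
    and nbr1: "\<And>y. \<lbrakk>y \<in> V; {us ! 1, y} \<in> E\<rbrakk> \<Longrightarrow> y \<in> set (take (d + 2) us) \<and> y \<noteq> us ! 0"
    and nbr2: "\<And>y. \<lbrakk>y \<in> V; {us ! 2, y} \<in> E\<rbrakk> \<Longrightarrow> y \<in> set (take (d + 2) us) \<and> y \<noteq> us ! 3"
    and linked: "k_linked k V E"
  shows "k \<le> d div 2"
proof (rule ccontr)
  assume "\<not> k \<le> d div 2"
  then have k: "d + 1 \<le> 2 * k" "2 \<le> k"
    using \<open>2 \<le> d\<close> by auto
  have len: "2 * k \<le> length us"
    using linked us distinct_card[of us] by (auto simp: k_linked_def)
  define s where "s i = us ! (2 * i)" for i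
  define t where "t i = us ! (2 * i + 1)" for i
  have "s ` {..<k} \<subseteq> V" "t ` {..<k} \<subseteq> V"
    using len us(2) by (auto simp: s_def t_def)
  moreover have "inj_on s {..<k}" "inj_on t {..<k}"
    using len us(1) by (auto simp: inj_on_def s_def t_def nth_eq_iff_index_eq)
  moreover have "s i \<noteq> t j" if "i < k" "j < k" for i j
  proof -
    have "2 * i \<noteq> 2 * j + 1"
      by presburger
    then show ?thesis
      using len us(1) that by (simp add: s_def t_def nth_eq_iff_index_eq)
  qed
  then have "s ` {..<k} \<inter> t ` {..<k} = {}"
    by blast
  ultimately obtain L where
    L: "\<And>i. i < k \<Longrightarrow> graph_path_joins V E (L i) (s i) (t i)"
    and disj: "\<And>i j. \<lbrakk>i < k; j < k; i \<noteq> j\<rbrakk> \<Longrightarrow> set (L i) \<inter> set (L j) = {}"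
    using linked unfolding k_linked_def by metis
  have terminal: "us ! j \<in> set (L (j div 2))" if "j < 2 * k" for j
  proof (cases "even j")
    case True
    then show ?thesis
      using graph_path_joins_ends(1)[OF L[of "j div 2"]] that by (auto simp: s_def)
  next
    case False
    then show ?thesis
      using graph_path_joins_ends(2)[OF L[of "j div 2"]] that by (auto simp: t_def)
  qed
  \<comment> \<open>An entry with index below \<open>2 * k\<close> is a terminal of the path
    numbered by half its index. By disjointness that path would be \<open>L i\<close>, making
    \<open>z\<close> one of its ends. The index is therefore at least \<open>2 * k\<close>, hence at
    least \<open>d + 1\<close>.\<close>
  have spare: "z = us ! (d + 1)"
    if "z \<in> set (L i)" "i < k" "z \<in> set (take (d + 2) us)" "z \<noteq> s i" "z \<noteq> t i" for z i
  proof -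
    obtain j where j: "j < d + 2" "j < length us" "z = us ! j"
      using \<open>z \<in> set (take (d + 2) us)\<close> by (auto simp: in_set_conv_nth)
    have "\<not> j < 2 * k"
    proof
      assume "j < 2 * k"
      then have "j div 2 < k"
        by linarith
      then have "j div 2 = i"
        using \<open>j < 2 * k\<close> terminal[of j] disj[of i "j div 2"] that j by auto
      then have "j = 2 * i \<or> j = 2 * i + 1"
        by presburger
      then show False
        using that j by (auto simp: s_def t_def)
    qed
    then have "j = d + 1"
      using j k by linarith
    then show ?thesis
      using j by simp
  qed
  have ends: "s 0 = us ! 0" "t 0 = us ! 1" "s 1 = us ! 2" "t 1 = us ! 3"
    by (simp_all add: s_def t_def)
  \<comment> \<open>The first path is reversed so that both paths start at a vertex whose neighbours
    are restricted.\<close>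
  have L0: "graph_path_joins V E (rev (L 0)) (t 0) (s 0)"
    and L1: "graph_path_joins V E (L 1) (s 1) (t 1)"
    using L[of 0] L[of 1] k graph_path_joins_rev by auto
  have "t 0 \<noteq> s 0" "s 1 \<noteq> t 1"
    using us(3) nth_eq_iff_index_eq[OF us(1), of 1 0] nth_eq_iff_index_eq[OF us(1), of 2 3]
    unfolding ends by linarith+
  obtain z where z: "z \<in> set (L 0)" "{t 0, z} \<in> E" "z \<noteq> t 0"
    using graph_path_joins_second[OF L0 \<open>t 0 \<noteq> s 0\<close>] by auto
  obtain w where w: "w \<in> set (L 1)" "{s 1, w} \<in> E" "w \<noteq> s 1"
    using graph_path_joins_second[OF L1 \<open>s 1 \<noteq> t 1\<close>] by auto
  have "z \<in> V" "w \<in> V"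
    using graph_path_joins_ends(3)[OF L0] graph_path_joins_ends(3)[OF L1] z w by auto
  then have "z = us ! (d + 1)" "w = us ! (d + 1)"
    using spare[of z 0] spare[of w 1] nbr1[of z] nbr2[of w] z w k unfolding ends by auto
  then show False
    using disj[of 0 1] z w k by auto
qed

section \<open>Edges and extreme points of convex hulls\<close>

text \<open>A face that meets \<open>open_segment a b\<close> contains \<open>a\<close> and
  \<open>b\<close>. If the segment from \<open>x\<close> to \<open>y\<close> were an edge,
  \<open>a\<close> would lie in its relative interior, contradicting extremality.\<close>

lemma crossing_segment_not_edge:
  fixes P :: "'a::euclidean_space set"
  assumes "convex P" "a \<in> P" "b \<in> P" "a extreme_point_of P" "x \<in> P" "y \<in> P" "a \<noteq> x" "a \<noteq> y"
    and "p \<in> open_segment a b" "p \<in> open_segment x y"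
  shows "{x, y} \<notin> polytope_edges P"
proof
  assume "{x, y} \<in> polytope_edges P"
  then have "closed_segment x y edge_of P"
    by (auto simp: polytope_edges_def doubleton_eq_iff closed_segment_commute)
  then have "closed_segment x y face_of P"
    by (simp add: edge_of_def)
  moreover have "p \<in> closed_segment x y"
    using assms by (auto simp: open_segment_def)
  ultimately have "a \<in> closed_segment x y"
    using assms unfolding face_of_def by blast
  then have "a \<in> open_segment x y"
    using assms by (simp add: open_segment_def)
  then show False
    using assms by (auto simp: extreme_point_of_def)
qed

text \<open>The hull of the other points stays in an open halfspace that misses
  \<open>x\<close>.\<close>

lemma extreme_point_of_convex_hull_functional:
  fixes S :: "'a::euclidean_space set"
  assumes "finite S" "x \<in> S" "\<And>y. \<lbrakk>y \<in> S; y \<noteq> x\<rbrakk> \<Longrightarrow> f \<bullet> x < f \<bullet> y"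
  shows "x extreme_point_of (convex hull S)"
proof -
  have "convex hull (S - {x}) \<subseteq> {y. f \<bullet> y > f \<bullet> x}"
    by (rule hull_minimal) (use assms(3) in \<open>auto simp: convex_halfspace_gt\<close>)
  then have "x \<notin> convex hull (S - {x})"
    by auto
  then have "x extreme_point_of (convex hull (insert x (S - {x})))"
    using assms(1) by (intro extreme_point_of_convex_hull_insert) auto
  then show ?thesis
    using assms(2) by (simp add: insert_absorb)
qed

lemma extreme_points_convex_hull_eq:
  fixes S :: "'a::euclidean_space set"
  assumes "\<And>x. x \<in> S \<Longrightarrow> x extreme_point_of (convex hull S)"
  shows "polytope_vertices (convex hull S) = S"
  using assms extreme_points_of_convex_hull[of S] by (auto simp: polytope_vertices_def)

section \<open>The iterated pyramid over a polygon inscribed in a parabola\<close>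

locale pyramid_over_polygon =
  fixes e\<^sub>1 e\<^sub>2 :: "'a::euclidean_space" and A :: "'a set" and m :: nat
  assumes basis: "e\<^sub>1 \<in> Basis" "e\<^sub>2 \<in> Basis" "A \<subseteq> Basis" "e\<^sub>1 \<noteq> e\<^sub>2" "e\<^sub>1 \<notin> A" "e\<^sub>2 \<notin> A"
    and m: "4 \<le> m"
begin

definition v :: "nat \<Rightarrow> 'a" where
  "v i = real i *\<^sub>R e\<^sub>1 + (real i)\<^sup>2 *\<^sub>R e\<^sub>2"

text \<open>The polygon spans the plane of \<open>e\<^sub>1\<close> and \<open>e\<^sub>2\<close>;
  the apexes are further basis vectors, so each one raises the dimension by one.\<close>

definition W :: "'a set" where
  "W = v ` {1..m} \<union> A"

definition P :: "'a set" where
  "P = convex hull W"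

lemma inner_basis:
  "e\<^sub>1 \<bullet> e\<^sub>1 = 1" "e\<^sub>2 \<bullet> e\<^sub>2 = 1" "e\<^sub>1 \<bullet> e\<^sub>2 = 0" "e\<^sub>2 \<bullet> e\<^sub>1 = 0"
  "a \<in> A \<Longrightarrow> a \<bullet> e\<^sub>1 = 0" "a \<in> A \<Longrightarrow> a \<bullet> e\<^sub>2 = 0" "a \<in> A \<Longrightarrow> e\<^sub>1 \<bullet> a = 0" "a \<in> A \<Longrightarrow> e\<^sub>2 \<bullet> a = 0"
  using basis by (auto simp: inner_Basis)

lemma v_eq_iff: "v i = v j \<longleftrightarrow> i = j"
proof
  assume "v i = v j"
  then have "v i \<bullet> e\<^sub>1 = v j \<bullet> e\<^sub>1"
    by simp
  then show "i = j"
    by (simp add: v_def inner_left_distrib inner_basis)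
qed simp

lemma v_notin_A: "v i \<notin> A"
proof
  assume "v i \<in> A"
  then have "v i \<bullet> v i = 0"
    by (subst (2) v_def) (simp add: inner_right_distrib inner_basis)
  then show False
    using \<open>v i \<in> A\<close> basis nonzero_Basis by auto
qed

lemma finite_A: "finite A"
  using basis finite_Basis finite_subset by blast

lemma finite_W: "finite W"
  by (simp add: W_def finite_A)

lemma card_W: "card W = m + card A"
proof -
  have "card (v ` {1..m}) = m"
    by (subst card_image) (auto simp: inj_on_def v_eq_iff)
  moreover have "v ` {1..m} \<inter> A = {}"
    using v_notin_A by blast
  ultimately show ?thesis
    by (simp add: W_def card_Un_disjoint finite_A)
qed

lemma polytope_P: "polytope P"
  using finite_W unfolding P_def polytope_def by blast

text \<open>
  The vertex \<open>v i\<close> is exposed by the tangent to the parabola at \<open>v i\<close>. The apexes lie strictly on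
  the right side of it because \<open>i \<ge> 1\<close>.
\<close>

lemma extreme_W:
  assumes "x \<in> W"
  shows "x extreme_point_of P"
  using assms unfolding W_def
proof
  assume "x \<in> v ` {1..m}"
  then obtain i where i: "x = v i" "1 \<le> i"
    by auto
  define f where "f = e\<^sub>2 - (2 * real i) *\<^sub>R e\<^sub>1"
  have fv: "f \<bullet> v j = (real j - real i)\<^sup>2 - (real i)\<^sup>2" for j
    by (simp add: f_def v_def inner_basis inner_right_distrib inner_diff_left power2_eq_square algebra_simps)
  have "f \<bullet> x < f \<bullet> y" if "y \<in> W" "y \<noteq> x" for y
    using \<open>y \<in> W\<close> unfolding W_def
  proof
    assume "y \<in> v ` {1..m}"
    then show ?thesis
      using i fv \<open>y \<noteq> x\<close> by auto
  next
    assume "y \<in> A"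
    then have "f \<bullet> y = 0"
      by (simp add: f_def inner_diff_left inner_basis)
    then show ?thesis
      using i fv by simp
  qed
  then show ?thesis
    unfolding P_def using extreme_point_of_convex_hull_functional[OF finite_W assms] by blast
next
  assume x: "x \<in> A"
  \<comment> \<open>An apex is orthogonal to all other generators.\<close>
  have "(- x) \<bullet> x < (- x) \<bullet> y" if "y \<in> W" "y \<noteq> x" for y
    using that x basis unfolding W_def
    by (auto simp: v_def inner_right_distrib inner_basis inner_Basis subset_iff)
  then show ?thesis
    unfolding P_def using extreme_point_of_convex_hull_functional[OF finite_W assms] by blast
qed

lemma vertices_P: "polytope_vertices P = W"
  unfolding P_def by (rule extreme_points_convex_hull_eq) (use extreme_W P_def in simp)

lemma W_subset_P: "W \<subseteq> P"
  by (simp add: P_def hull_subset)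

lemma aff_dim_P: "aff_dim P = int (card A + 2)"
proof -
  have vW: "v 1 \<in> W" "v 2 \<in> W" "v 3 \<in> W"
    using m by (auto simp: W_def)
  \<comment> \<open>Third differences of the quadratic map \<open>v\<close> vanish and
    \<open>v 0 = 0\<close>. The coefficients sum to 1, so the origin is in the affine hull and the
    affine dimension equals the linear one.\<close>
  have "3 *\<^sub>R v 1 + (- 3) *\<^sub>R v 2 + 1 *\<^sub>R v 3 = 0"
  proof -
    have "3 *\<^sub>R v 1 + (- 3) *\<^sub>R v 2 + 1 *\<^sub>R v 3 
      = (3 - 3 * 2 + 3) *\<^sub>R e\<^sub>1 + (3 - 3 * 4 + 9) *\<^sub>R e\<^sub>2"
      unfolding v_def by (simp add: algebra_simps flip: scaleR_add_left scaleR_diff_left)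
    then show ?thesis by simp
  qed
  then have "0 \<in> affine hull {v 1, v 2, v 3}"
    unfolding affine_hull_3 by (smt (verit) mem_Collect_eq)
  then have 0: "0 \<in> affine hull W"
    using hull_mono[of "{v 1, v 2, v 3}" W affine] vW by auto
  let ?B = "insert e\<^sub>1 (insert e\<^sub>2 A)"
  have v12: "v 1 \<in> span W" "v 2 \<in> span W"
    using vW span_base by auto
  have "e\<^sub>2 = (1 / 2) *\<^sub>R (v 2 - 2 *\<^sub>R v 1)"
    unfolding v_def by (simp add: algebra_simps flip: scaleR_add_left scaleR_diff_left)
  then have e2: "e\<^sub>2 \<in> span W"
    using v12 by (metis span_diff span_scale)
  have "e\<^sub>1 = v 1 - e\<^sub>2"
    by (simp add: v_def)
  then have "e\<^sub>1 \<in> span W"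
    using v12 e2 by (metis span_diff)
  moreover have "A \<subseteq> span W"
    using span_superset[of W] by (auto simp: W_def)
  ultimately have "?B \<subseteq> span W"
    using e2 by blast
  moreover have "W \<subseteq> span ?B"
    by (auto simp: W_def v_def intro!: span_add span_scale intro: span_base)
  ultimately have "span W = span ?B"
    by (metis span_eq)
  moreover have "independent ?B"
    by (rule independent_mono[OF independent_Basis]) (use basis in auto)
  moreover have "card ?B = card A + 2"
    using basis finite_A by simp
  ultimately have "dim W = card A + 2"
    by (metis dim_eq_card)
  then show ?thesis
    using aff_dim_zero[OF 0] by (simp add: P_def aff_dim_convex_hull)
qed

section \<open>Crossing chords of the parabola\<close>

text \<open>The line through the points of the parabola at \<open>a\<close> and \<open>c\<close> has
  slope \<open>a + c\<close> and intercept \<open>- a * c\<close>.\<close>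

lemma v_on_chord:
  assumes "a < c" and x: "real a < x" "x < real c"
  shows "x *\<^sub>R e\<^sub>1 + ((real a + real c) * x - real a * real c) *\<^sub>R e\<^sub>2 \<in> open_segment (v a) (v c)"
proof -
  define u where "u = (x - real a) / (real c - real a)"
  have u: "0 < u" "u < 1"
    using assms by (auto simp: u_def field_simps)
  have "u * (real c - real a) = x - real a"
    using assms by (simp add: u_def)
  then have x_eq: "x = (1 - u) * real a + u * real c"
    by (simp add: algebra_simps)
  have "(real a + real c) * x - real a * real c = (1 - u) * (real a)\<^sup>2 + u * (real c)\<^sup>2"
    unfolding x_eq by (simp add: algebra_simps power2_eq_square)
  then have "x *\<^sub>R e\<^sub>1 + ((real a + real c) * x - real a * real c) *\<^sub>R e\<^sub>2 = (1 - u) *\<^sub>R v a + u *\<^sub>R v c"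
    by (simp add: v_def x_eq scaleR_add_right scaleR_add_left)
  then show ?thesis
    using u assms by (auto simp: in_segment v_eq_iff)
qed

lemma crossing_chords:
  assumes "a < b" "b < c" "c < e"
  obtains p where "p \<in> open_segment (v a) (v c)" "p \<in> open_segment (v b) (v e)"
proof -
  define D where "D = real b + real e - real a - real c"
  \<comment> \<open>The abscissa at which the two chord lines meet. The factorisations below place
    it strictly between \<open>b\<close> and \<open>c\<close>, hence inside both chords.\<close>
  define x where "x = (real b * real e - real a * real c) / D"
  have D: "0 < D"
    using assms by (simp add: D_def)
  then have xD: "x * D = real b * real e - real a * real c"
    by (simp add: x_def)
  have "(x - real b) * D = (real b - real a) * (real c - real b)"
    using xD by (simp add: D_def algebra_simps)
  moreover have "0 < (real b - real a) * (real c - real b)"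
    using assms by simp
  ultimately have b: "real b < x"
    using D by (metis diff_gt_0_iff_gt zero_less_mult_pos2)
  have "(real c - x) * D = (real c - real b) * (real e - real c)"
    using xD by (simp add: D_def algebra_simps)
  moreover have "0 < (real c - real b) * (real e - real c)"
    using assms by simp
  ultimately have c: "x < real c"
    using D by (metis diff_gt_0_iff_gt zero_less_mult_pos2)
  have "(real a + real c) * x - real a * real c = (real b + real e) * x - real b * real e"
    using xD by (simp add: D_def algebra_simps)
  then show thesis
    using that v_on_chord[of a c x] v_on_chord[of b e x] b c assms by simp
qed

lemma chord_not_edge:
  assumes "1 \<le> a" "a < b" "b < c" "c < e" "e \<le> m"
  shows "{v a, v c} \<notin> polytope_edges P" "{v b, v e} \<notin> polytope_edges P"
proof -
  obtain p where p: "p \<in> open_segment (v a) (v c)" "p \<in> open_segment (v b) (v e)"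
    using crossing_chords assms by blast
  have "v a \<in> W" "v b \<in> W" "v c \<in> W" "v e \<in> W"
    using assms by (auto simp: W_def)
  moreover have "convex P"
    by (simp add: P_def)
  ultimately show "{v a, v c} \<notin> polytope_edges P" "{v b, v e} \<notin> polytope_edges P"
    using crossing_segment_not_edge[of P "v b" "v e" "v a" "v c" p]
      crossing_segment_not_edge[of P "v a" "v c" "v b" "v e" p]
      p assms extreme_W W_subset_P
    by (auto simp: v_eq_iff)
qed

section \<open>The linkedness bound for the pyramid and for the class\<close>

lemma k_linked_P_le:
  assumes "k_linked k (polytope_vertices P) (polytope_edges P)"
  shows "k \<le> (card A + 2) div 2"
proof -
  obtain xs where xs: "distinct xs" "set xs = A"
    using finite_distinct_list[OF finite_A] by blast
  have len_xs: "length xs = card A"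
    using xs distinct_card by fastforce
  \<comment> \<open>The two crossing pairs come first, then the apexes, which the remaining pairs
    are to occupy, and last the other polygon vertices.\<close>
  define us where "us = [v 1, v 3, v 2, v 4] @ xs @ map v [5..<m + 1]"
  have "distinct us"
    using xs v_notin_A by (auto simp: us_def v_eq_iff distinct_map inj_on_def)
  moreover have "set us = W"
  proof -
    have "{1..m} = {1, 3, 2, 4} \<union> {5..<m + 1}"
      using m by auto
    then show ?thesis
      using xs by (auto simp: us_def W_def)
  qed
  ultimately have us: "distinct us" "set us = W" "4 \<le> length us"
    by (simp_all add: us_def)
  have take_us: "set (take (card A + 2 + 2) us) = {v 1, v 3, v 2, v 4} \<union> A"
    using xs len_xs by (simp add: us_def)
  have nbr1: "y \<in> set (take (card A + 2 + 2) us) \<and> y \<noteq> us ! 0"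
    if "y \<in> W" "{us ! 1, y} \<in> polytope_edges P" for y
  proof (cases "y \<in> A")
    case True
    then show ?thesis
      unfolding take_us using v_notin_A by (auto simp: us_def)
  next
    case False
    then obtain j where j: "y = v j" "1 \<le> j" "j \<le> m"
      using \<open>y \<in> W\<close> by (auto simp: W_def)
    have "{v 3, v j} \<in> polytope_edges P"
      using that j by (simp add: us_def)
    then have "j \<noteq> 1" "\<not> 5 \<le> j"
      using chord_not_edge(1)[of 1 2 3 4] chord_not_edge(2)[of 2 3 4 j] m j
      by (auto simp: insert_commute)
    then have "j = 2 \<or> j = 3 \<or> j = 4"
      using j by linarith
    then show ?thesis
      unfolding take_us using j by (auto simp: us_def v_eq_iff)
  qed
  have nbr2: "y \<in> set (take (card A + 2 + 2) us) \<and> y \<noteq> us ! 3"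
    if "y \<in> W" "{us ! 2, y} \<in> polytope_edges P" for y
  proof (cases "y \<in> A")
    case True
    then show ?thesis
      unfolding take_us using v_notin_A by (auto simp: us_def)
  next
    case False
    then obtain j where j: "y = v j" "1 \<le> j" "j \<le> m"
      using \<open>y \<in> W\<close> by (auto simp: W_def)
    have "{v 2, v j} \<in> polytope_edges P"
      using that j by (simp add: us_def)
    \<comment> \<open>Here the crossing chord joins \<open>v 1\<close> and
      \<open>v 3\<close>.\<close>
    then have "\<not> 4 \<le> j"
      using chord_not_edge(2)[of 1 2 3 j] j by auto
    then have "j = 1 \<or> j = 2 \<or> j = 3"
      using j by linarith
    then show ?thesis
      unfolding take_us using j by (auto simp: us_def v_eq_iff)
  qed
  show ?thesis
    by (rule k_linked_le_of_crossing[OF us _ nbr1 nbr2]) (use assms vertices_P in auto)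
qed

lemma linkedness_P_le: "linkedness P \<le> (card A + 2) div 2"
proof -
  let ?K = "{k. k_linked k (polytope_vertices P) (polytope_edges P)}"
  \<comment> \<open>\<open>Max\<close> is meaningful only on a finite nonempty set: the bound gives
    finiteness, \<open>0\<close> gives nonemptiness.\<close>
  have "?K \<subseteq> {..(card A + 2) div 2}"
    using k_linked_P_le by auto
  moreover have "0 \<in> ?K"
    by (simp add: k_linked_0)
  ultimately show ?thesis
    unfolding linkedness_def using finite_subset[of ?K] by (subst Max_le_iff) auto
qed

end

theorem theorem2p3:
  fixes d \<gamma> :: nat
  assumes "d \<ge> 2" and "\<gamma> \<ge> 1" and "d \<le> DIM('a::euclidean_space)"
  shows "min_linkedness TYPE('a) d \<gamma> \<le> d div 2"
proof -
  obtain B :: "'a set" where B: "B \<subseteq> Basis" "card B = d" "finite B"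
    using obtain_subset_with_card_n[OF assms(3)] by metis
  obtain C where C: "C \<subseteq> B" "card C = 2"
    using obtain_subset_with_card_n[of 2 B] assms(1) B by metis
  then obtain e\<^sub>1 e\<^sub>2 where e: "C = {e\<^sub>1, e\<^sub>2}" "e\<^sub>1 \<noteq> e\<^sub>2"
    by (meson card_2_iff)
  \<comment> \<open>With \<open>d - 2\<close> apexes, \<open>\<gamma> + 3\<close> polygon vertices
    give \<open>d + \<gamma> + 1\<close> in total; \<open>\<gamma> \<ge> 1\<close> provides the four
    that the crossing uses.\<close>
  interpret pyramid_over_polygon e\<^sub>1 e\<^sub>2 "B - C" "\<gamma> + 3"
    by unfold_locales (use B C e assms in auto)
  have A: "card (B - C) + 2 = d"
    using B C assms(1) by (simp add: card_Diff_subset finite_subset)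
  then have "P \<in> polytope_class d \<gamma>"
    using polytope_P aff_dim_P vertices_P card_W by (simp add: polytope_class_def)
  then have "{k. \<forall>Q \<in> (polytope_class d \<gamma> :: 'a set set). linkedness Q \<ge> k} \<subseteq> {..d div 2}" (is "?K \<subseteq> _")
    using linkedness_P_le A by fastforce
  moreover have "0 \<in> ?K"
    by simp
  ultimately show ?thesis
    unfolding min_linkedness_def using finite_subset[of ?K] by (subst Max_le_iff) auto
qed

end
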